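(* Let $Y$ and $C$ be independent absolutely continuous nonnegative random variables, and define $$Z=\max\{Y,C\},\qquad \delta=\mathbf 1_{\{Y\geqslant C\}}.$$ Then $Z$ and $\delta$ are independent if and only if there exists a constant $\beta>0$ such that $$r_C(t)=\beta r_Y(t),\qquad t\geqslant 0,$$ where $r_Y$ and $r_C$ denote the reversed hazard rate functions of $Y$ and $C$, respectively.
   Context: For an absolutely continuous nonnegative random variable $X$ with density $f_X$ and distribution function $F_X(t)=\mathbb P(X\leqslant t)$, the reversed hazard rate is $r_X(t)=f_X(t)/F_X(t)$. $\mathbf 1$ denotes an indicator.
   Formalization: The formal theorem additionally assumes 0 < P(δ=1) < 1 (the claim fails for Y uniform on [0,1], C uniform on [2,3], where δ is a.s. constant), and reads r_C(t) = β r_Y(t) for almost every t ≥ 0, since densities are defined only up to null sets. *)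

theory Defs
  imports "HOL-Probability.Probability"
begin

text \<open>
  The parameter \<open>f\<close> is a version of the density of \<open>X\<close>; two versions agree only almost everywhere,
  so identities between reversed hazard rates are meaningful only up to Lebesgue null sets.
  Where the distribution function vanishes, \<open>f t / 0 = 0\<close>. In particular a proportionality
  \<open>r\<^sub>C = \<beta> r\<^sub>Y\<close> with \<open>\<beta> > 0\<close> forces the distribution functions of \<open>Y\<close> and \<open>C\<close> to vanish on the
  same half-line, so that this convention never decides whether the proportionality holds.
\<close>

definition reversed_hazard_rate ::
    "'a measure \<Rightarrow> ('a \<Rightarrow> real) \<Rightarrow> (real \<Rightarrow> real) \<Rightarrow> real \<Rightarrow> real" where
  "reversed_hazard_rate M X f t = f t / cdf (distr M borel X) t"

end

theory Submission
  imports Defs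
begin

text \<open>
  Write \<open>F\<close>, \<open>G\<close> for the distribution functions of \<open>Y\<close>, \<open>C\<close>. On \<open>{\<delta> = 1}\<close> the variable \<open>Z\<close> has the
  subdensity \<open>f\<^sub>Y G\<close>, and on \<open>{\<delta> = 0}\<close> it has the subdensity \<open>f\<^sub>C F\<close>. Hence \<open>Z\<close> and \<open>\<delta>\<close> are
  independent iff these subdensities are proportional almost everywhere, and dividing by \<open>F G\<close> gives
  the proportionality of the reversed hazard rates wherever \<open>F G > 0\<close>. It remains to see that under
  independence \<open>F\<close> and \<open>G\<close> have the same zeros. If \<open>F a = 0 < G a\<close> with \<open>a\<close> the largest zero of \<open>F\<close>, then
  \<open>G a * F t \<le> P(Z \<le> t, \<delta> = 1) = p * F t * G t\<close> for \<open>t > a\<close>, and letting \<open>t\<close> tend to \<open>a\<close> gives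
  \<open>G a \<le> p * G a\<close>, contradicting \<open>p < 1\<close>.
\<close>

section \<open>Zeros of an atomless distribution function\<close>

text \<open>The limit 1 at infinity bounds the zeros from above, monotonicity makes them a down-set,
  and left continuity, which is where atomlessness enters, puts their supremum among them.\<close>

lemma (in real_distribution) cdf_zeros_atomless:
  assumes atomless: "\<And>x. measure M {x} = 0" and s: "cdf M s = 0"
  obtains a where "s \<le> a" "\<And>t. cdf M t = 0 \<longleftrightarrow> t \<le> a"
proof -
  have "eventually (\<lambda>t. cdf M t > 0) at_top"
    using order_tendstoD(1)[OF cdf_lim_at_top, of 0] prob_space by simp
  then obtain b where b: "\<And>t. t \<ge> b \<Longrightarrow> cdf M t > 0"
    by (auto simp: eventually_at_top_linorder)
  define S where "S = {t. cdf M t = 0}"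
  have "t \<le> b" if "t \<in> S" for t
    using b[of t] that by (force simp: S_def)
  then have bdd: "bdd_above S"
    by (auto simp: bdd_above_def)
  have ne: "s \<in> S"
    using s by (simp add: S_def)
  have below: "cdf M t = 0" if t: "t < Sup S" for t
  proof -
    obtain u where "u \<in> S" "t < u"
      using less_cSupD[OF _ t] ne by blast
    then show ?thesis
      using cdf_nondecreasing[of t u] cdf_nonneg[of t] by (simp add: S_def)
  qed
  have "(cdf M \<longlongrightarrow> cdf M (Sup S)) (at_left (Sup S))"
    using isCont_cdf[of "Sup S"] atomless[of "Sup S"] by (simp add: isCont_def filterlim_at_split)
  moreover have "(cdf M \<longlongrightarrow> 0) (at_left (Sup S))"
    by (rule tendsto_eventually) (auto simp: eventually_at_filter below)
  ultimately have "cdf M (Sup S) = 0"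
    by (rule tendsto_unique[rotated]) simp
  then have "cdf M t = 0" if "t \<le> Sup S" for t
    using below[of t] that by (cases "t = Sup S") simp_all
  moreover have "t \<le> Sup S" if "cdf M t = 0" for t
    using that cSup_upper[OF _ bdd, of t] by (simp add: S_def)
  ultimately show thesis
    using cSup_upper[OF ne bdd] by (intro that[of "Sup S"]) blast+
qed

context prob_space
begin

section \<open>Variables with a density\<close>

lemma cdf_distr:
  assumes "random_variable borel X"
  shows "cdf (distr M borel X) t = prob {\<omega> \<in> space M. X \<omega> \<le> t}"
  using assms by (simp add: cdf_def measure_distr vimage_def Int_def conj_commute)

lemma distributed_lborel_atomless:
  fixes X :: "'a \<Rightarrow> real"
  assumes X: "distributed M lborel X f"
  shows "emeasure (distr M borel X) {x} = 0"
proof -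
  have "distr M borel X = density lborel f"
    using distributed_distr_eq_density[OF X] by (metis distr_cong sets_lborel)
  moreover have "AE y in lborel. y \<notin> {x}"
    by (rule AE_lborel_singleton[THEN AE_mp]) auto
  ultimately show ?thesis
    using distributed_borel_measurable[OF X]
    by (auto simp: emeasure_density nn_integral_0_iff_AE split: split_indicator elim!: eventually_mono)
qed

text \<open>The zeros form a half-line \<open>{..a}\<close> of mass 0, and a nonnegative function
  with integral 0 over it vanishes there almost everywhere. This controls the points where a
  reversed hazard rate divides by 0.\<close>

lemma AE_density_zero_where_cdf_zero:
  fixes X :: "'a \<Rightarrow> real"
  assumes X: "distributed M lborel X (\<lambda>t. ennreal (f t))" and nonneg: "\<And>t. 0 \<le> f t"
  shows "AE t in lborel. cdf (distr M borel X) t = 0 \<longrightarrow> f t = 0"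
proof (cases "\<exists>s. cdf (distr M borel X) s = 0")
  case True
  have [measurable]: "random_variable borel X"
    using distributed_measurable[OF X] by simp
  interpret D: real_distribution "distr M borel X"
    by (rule real_distribution_distr) simp
  obtain a where a: "\<And>t. cdf (distr M borel X) t = 0 \<longleftrightarrow> t \<le> a"
    using True D.cdf_zeros_atomless distributed_lborel_atomless[OF X]
    by (metis measure_eq_emeasure_eq_ennreal ennreal_0 order_refl)
  have [measurable]: "(\<lambda>t. ennreal (f t)) \<in> borel_measurable lborel"
    by (rule distributed_borel_measurable[OF X])
  have "(\<integral>\<^sup>+ t. ennreal (f t) * indicator {..a} t \<partial>lborel) = emeasure (distr M borel X) {..a}"
    using distributed_emeasure[OF X, of "{..a}"] by (simp add: emeasure_distr)
  also have "\<dots> = 0"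
    using a[of a] by (simp add: cdf_def D.emeasure_eq_measure)
  finally have "AE t in lborel. ennreal (f t) * indicator {..a} t = 0"
    by (subst (asm) nn_integral_0_iff_AE) auto
  then show ?thesis
    by eventually_elim (use nonneg in \<open>auto simp: a ennreal_eq_0_iff intro: antisym split: split_indicator_asm\<close>)
qed auto

section \<open>Comparing two independent variables\<close>

text \<open>By independence the joint law is a product measure; it is integrated section by section
  over the density of \<open>X\<close>.\<close>

lemma emeasure_indep_var_Pair:
  fixes X :: "'a \<Rightarrow> real"
  assumes indep: "indep_var borel X borel W" and X: "distributed M lborel X f"
    and R: "R \<in> sets (borel \<Otimes>\<^sub>M borel)"
  shows "emeasure M {\<omega> \<in> space M. (X \<omega>, W \<omega>) \<in> R} =
    (\<integral>\<^sup>+ x. f x * emeasure (distr M borel W) (Pair x -` R) \<partial>lborel)"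
proof -
  note [measurable] = indep_var_rv1[OF indep] indep_var_rv2[OF indep] R
  have [measurable]: "f \<in> borel_measurable lborel"
    by (rule distributed_borel_measurable[OF X])
  interpret W: prob_space "distr M borel W"
    by (rule prob_space_distr) simp
  have XD: "distr M borel X = density lborel f"
    using distributed_distr_eq_density[OF X] by (metis distr_cong sets_lborel)
  have m: "(\<lambda>x. emeasure (distr M borel W) (Pair x -` R)) \<in> borel_measurable lborel"
    using W.measurable_emeasure_Pair[of R borel] R by (simp cong: measurable_cong_sets)
  have "emeasure M {\<omega> \<in> space M. (X \<omega>, W \<omega>) \<in> R}
      = emeasure (distr M (borel \<Otimes>\<^sub>M borel) (\<lambda>\<omega>. (X \<omega>, W \<omega>))) R"
    by (subst emeasure_distr) (auto intro!: arg_cong[where f = "emeasure M"])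
  also have "\<dots> = emeasure (distr M borel X \<Otimes>\<^sub>M distr M borel W) R"
    using indep by (simp add: indep_var_distribution_eq)
  also have "\<dots> = (\<integral>\<^sup>+ x. emeasure (distr M borel W) (Pair x -` R) \<partial>density lborel f)"
    unfolding XD using R by (intro W.emeasure_pair_measure_alt) (simp cong: sets_pair_measure_cong)
  also have "\<dots> = (\<integral>\<^sup>+ x. f x * emeasure (distr M borel W) (Pair x -` R) \<partial>lborel)"
    by (rule nn_integral_density) (use m in simp_all)
  finally show ?thesis .
qed

text \<open>The section at \<open>x\<close> is \<open>{..x}\<close> if \<open>x\<close> lies in
  \<open>A\<close> and empty otherwise, so the factor multiplying the density is the distribution
  function of \<open>W\<close>.\<close>

lemma emeasure_dominating_in:
  fixes X :: "'a \<Rightarrow> real"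
  assumes indep: "indep_var borel X borel W"
    and X: "distributed M lborel X (\<lambda>t. ennreal (f t))" and nonneg: "\<And>t. 0 \<le> f t"
    and A: "A \<in> sets borel"
  shows "emeasure M {\<omega> \<in> space M. X \<omega> \<in> A \<and> W \<omega> \<le> X \<omega>} =
    emeasure (density lborel (\<lambda>t. ennreal (f t * cdf (distr M borel W) t))) A"
proof -
  note [measurable] = indep_var_rv2[OF indep] A
  have [measurable]: "f \<in> borel_measurable lborel"
    using distributed_real_measurable[OF _ X] nonneg by simp
  interpret D: real_distribution "distr M borel W"
    by (rule real_distribution_distr) simp
  have [measurable]: "cdf (distr M borel W) \<in> borel_measurable borel"
    by (intro borel_measurable_mono monoI D.cdf_nondecreasing)
  let ?R = "{z :: real \<times> real. fst z \<in> A \<and> snd z \<le> fst z}"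
  have "{z \<in> space (borel \<Otimes>\<^sub>M borel). fst z \<in> A \<and> snd z \<le> fst z} \<in> sets (borel \<Otimes>\<^sub>M borel)"
    by measurable
  then have "?R \<in> sets (borel \<Otimes>\<^sub>M borel)"
    by (simp add: space_pair_measure)
  moreover have "ennreal (f x) * emeasure (distr M borel W) (Pair x -` ?R)
      = ennreal (f x * cdf (distr M borel W) x) * indicator A x" for x
    by (cases "x \<in> A")
      (auto simp: vimage_def cdf_def D.emeasure_eq_measure ennreal_mult nonneg atMost_def)
  ultimately show ?thesis
    using emeasure_indep_var_Pair[OF indep X, of ?R] by (simp add: emeasure_density)
qed

text \<open>Each section of the diagonal is a single point, hence null for \<open>W\<close>. Ties
  can thus be ignored when weak and strict comparisons are exchanged.\<close>

lemma indep_var_atomless_neq: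
  fixes X :: "'a \<Rightarrow> real"
  assumes indep: "indep_var borel X borel W" and X: "distributed M lborel X f"
    and atomless: "\<And>x. emeasure (distr M borel W) {x} = 0"
  shows "AE \<omega> in M. X \<omega> \<noteq> W \<omega>"
proof -
  note [measurable] = indep_var_rv1[OF indep] indep_var_rv2[OF indep]
  let ?R = "{z :: real \<times> real. fst z = snd z}"
  have "{z \<in> space (borel \<Otimes>\<^sub>M (borel :: real measure)). fst z = snd z} \<in> sets (borel \<Otimes>\<^sub>M borel)"
    by measurable
  then have R: "?R \<in> sets (borel \<Otimes>\<^sub>M borel)"
    by (simp add: space_pair_measure)
  have "Pair x -` ?R = {x}" for x
    by auto
  then have "emeasure M {\<omega> \<in> space M. X \<omega> = W \<omega>} = 0"
    using emeasure_indep_var_Pair[OF indep X R] by (simp add: atomless)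
  then show ?thesis
    by (subst AE_iff_measurable[OF _ refl]) simp_all
qed

section \<open>Independence from an indicator\<close>

text \<open>An indicator generates only the empty event, \<open>S\<close>, its complement and the
  whole space; the product rule for \<open>S\<close> yields that for the complement by
  subtraction.\<close>

lemma indep_var_indicator_iff:
  fixes Z :: "'a \<Rightarrow> real"
  assumes [measurable]: "random_variable borel Z" "S \<inter> space M \<in> events"
  shows "indep_var borel Z borel (indicator S :: 'a \<Rightarrow> real) \<longleftrightarrow>
    (\<forall>A \<in> sets borel. prob {\<omega> \<in> space M. Z \<omega> \<in> A \<and> \<omega> \<in> S} =
      prob {\<omega> \<in> space M. Z \<omega> \<in> A} * prob (S \<inter> space M))"
    (is "?L \<longleftrightarrow> ?R")
proof
  assume ?L
  show ?R
  proof
    fix A :: "real set" assume "A \<in> sets borel"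
    with indep_varD[OF \<open>?L\<close>, of A "{1}"]
    show "prob {\<omega> \<in> space M. Z \<omega> \<in> A \<and> \<omega> \<in> S} =
        prob {\<omega> \<in> space M. Z \<omega> \<in> A} * prob (S \<inter> space M)"
      by (simp add: vimage_def indicator_eq_1_iff Int_def conj_ac)
  qed
next
  assume R: ?R
  have rv: "random_variable borel (indicator S :: 'a \<Rightarrow> real)"
    by (simp add: borel_measurable_indicator_iff)
  have *: "prob ((Z -` A \<inter> space M) \<inter> (indicator S -` B \<inter> space M)) =
      prob (Z -` A \<inter> space M) * prob (indicator S -` B \<inter> space M)"
    if A: "A \<in> sets borel" for A and B :: "real set"
  proof -
    let ?A = "Z -` A \<inter> space M" and ?S = "S \<inter> space M"
    have ev [measurable]: "?A \<in> events" "?S \<in> events"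
      using A by (auto intro: measurable_sets)
    have 1: "prob (?A \<inter> ?S) = prob ?A * prob ?S"
      using R A by (simp add: vimage_def Int_def conj_ac)
    have "?A \<inter> (space M - ?S) = ?A - ?S"
      by auto
    also have "prob (?A - ?S) = prob ?A - prob (?A \<inter> ?S)"
      by (rule finite_measure_Diff') auto
    also have "\<dots> = prob ?A * (1 - prob ?S)"
      unfolding 1 by (simp add: algebra_simps)
    finally have 2: "prob (?A \<inter> (space M - ?S)) = prob ?A * prob (space M - ?S)"
      unfolding prob_compl[OF ev(2)] .
    have B: "indicator S -` B \<inter> space M =
      (if 1 \<in> B then if 0 \<in> B then space M else ?S else if 0 \<in> B then space M - ?S else {})"
      by (auto simp: indicator_def of_bool_def split: if_splits)
    show ?thesis
      unfolding B using 1 2 by (auto simp: prob_space)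
  qed
  \<comment> \<open>Preimages are closed under intersection, so the product rule for them extends to
    the generated sigma-algebras in \<open>indep_var_eq\<close>.\<close>
  have Int_stable: "Int_stable {X -` A \<inter> space M | A. A \<in> sets borel}" for X :: "'a \<Rightarrow> real"
  proof (rule Int_stableI, clarify)
    fix A B :: "real set" assume "A \<in> sets borel" "B \<in> sets borel"
    then show "\<exists>C. X -` A \<inter> space M \<inter> (X -` B \<inter> space M) = X -` C \<inter> space M \<and> C \<in> sets borel"
      by (intro exI[of _ "A \<inter> B"]) auto
  qed
  show ?L
    unfolding indep_var_eq
    by (intro conjI assms rv indep_set_sigma_sets indep_setI Int_stable)
      (use rv * in \<open>auto intro: measurable_sets\<close>)
qed

section \<open>Transfer of zeros between the distribution functions\<close>

text \<open>Of the independence of \<open>Z\<close> and \<delta>, only the inequality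
  \<open>le\<close> enters. The generic \<open>X\<close>, \<open>W\<close> and \<open>p\<close>
  permit a second application with the variables exchanged and \<open>1 - p\<close> for
  \<open>p\<close>.\<close>

lemma cdf_zero_transfer:
  fixes X W :: "'a \<Rightarrow> real"
  assumes indep: "indep_var borel X borel W"
    and atomless: "\<And>x. emeasure (distr M borel X) {x} = 0"
    and "p < 1"
    and le: "\<And>t. prob {\<omega> \<in> space M. X \<omega> \<le> t \<and> W \<omega> < X \<omega>} \<le>
      p * (cdf (distr M borel X) t * cdf (distr M borel W) t)"
    and zero: "cdf (distr M borel X) s = 0"
  shows "cdf (distr M borel W) s = 0"
proof -
  note [measurable] = indep_var_rv1[OF indep] indep_var_rv2[OF indep]
  interpret X: real_distribution "distr M borel X"
    by (rule real_distribution_distr) simp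
  interpret W: real_distribution "distr M borel W"
    by (rule real_distribution_distr) simp
  define F G where "F = cdf (distr M borel X)" and "G = cdf (distr M borel W)"
  obtain a where "s \<le> a" and a: "\<And>t. F t = 0 \<longleftrightarrow> t \<le> a"
    using X.cdf_zeros_atomless[OF _ zero] atomless unfolding F_def
    by (metis measure_eq_emeasure_eq_ennreal ennreal_0 order_refl)
  \<comment> \<open>The rectangle \<open>a < X \<le> t\<close>, \<open>W \<le> a\<close> lies in the
    event of \<open>le\<close>. Since \<open>F a = 0\<close>, it has probability
    \<open>F t * G a\<close>, and the positive factor \<open>F t\<close> cancels.\<close>
  have bound: "G a \<le> p * G t" if "a < t" for t
  proof -
    have "prob ((\<lambda>\<omega>. (X \<omega>, W \<omega>)) -` ({a<..t} \<times> {..a}) \<inter> space M)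
        = prob (X -` {a<..t} \<inter> space M) * prob (W -` {..a} \<inter> space M)"
      by (rule indep_varD[OF indep]) auto
    also have "\<dots> = (F t - F a) * G a"
      using X.cdf_diff_eq[OF that] by (simp add: F_def G_def cdf_def measure_distr)
    also have "\<dots> = F t * G a"
      using a[of a] by simp
    finally have "F t * G a = prob ((\<lambda>\<omega>. (X \<omega>, W \<omega>)) -` ({a<..t} \<times> {..a}) \<inter> space M)"
      by simp
    also have "\<dots> \<le> prob {\<omega> \<in> space M. X \<omega> \<le> t \<and> W \<omega> < X \<omega>}"
      by (rule finite_measure_mono) auto
    also note le[of t]
    finally have "F t * G a \<le> F t * (p * G t)"
      by (simp add: F_def G_def algebra_simps)
    moreover have "F t > 0"
      using a[of t] that X.cdf_nonneg[of t] by (simp add: F_def less_le)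
    ultimately show ?thesis
      by simp
  qed
  have "(G \<longlongrightarrow> G a) (at_right a)"
    using W.cdf_is_right_cont by (simp add: G_def continuous_within)
  then have "((\<lambda>t. p * G t) \<longlongrightarrow> p * G a) (at_right a)"
    by (rule tendsto_mult_left)
  then have "G a \<le> p * G a"
    by (rule tendsto_lowerbound) (auto simp: eventually_at_filter bound)
  then have "(1 - p) * G a \<le> 0"
    by (simp add: algebra_simps)
  then have "G a \<le> 0"
    using \<open>p < 1\<close> by (simp add: mult_le_0_iff)
  then show ?thesis
    using W.cdf_nondecreasing[OF \<open>s \<le> a\<close>] W.cdf_nonneg[of s] by (simp add: G_def)
qed

lemma indep_var_swap:
  assumes "indep_var N X K W"
  shows "indep_var K W N X"
proof -
  let ?X = "sigma_sets (space M) {X -` A \<inter> space M | A. A \<in> sets N}"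
  let ?W = "sigma_sets (space M) {W -` A \<inter> space M | A. A \<in> sets K}"
  have XW: "indep_set ?X ?W"
    using assms unfolding indep_var_eq by (rule conjunct2)
  have "indep_set ?W ?X"
  proof (rule indep_setI)
    fix a b assume "a \<in> ?W" "b \<in> ?X"
    from indep_setD[OF XW this(2,1)] show "prob (a \<inter> b) = prob a * prob b"
      by (simp only: Int_commute mult.commute)
  qed (rule indep_setD_ev2[OF XW], rule indep_setD_ev1[OF XW])
  then show ?thesis
    unfolding indep_var_eq using indep_var_rv1[OF assms] indep_var_rv2[OF assms] by blast
qed

lemma cdf_nonneg_variable:
  fixes X :: "'a \<Rightarrow> real"
  assumes [measurable]: "random_variable borel X" and "AE \<omega> in M. 0 \<le> X \<omega>" and "t < 0"
  shows "cdf (distr M borel X) t = 0"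
proof -
  have "AE \<omega> in M. \<not> X \<omega> \<le> t"
    using assms(2) by eventually_elim (use \<open>t < 0\<close> in auto)
  then show ?thesis
    by (simp add: cdf_distr prob_eq_0)
qed

end

section \<open>The equivalence\<close>

text \<open>\<open>nondegenerate\<close> excludes an almost surely constant \<delta>: it would be
  independent of \<open>Z\<close>, whereas proportional rates force \<delta> = 1 to have probability
  1/(1 + \<beta>), strictly between 0 and 1.\<close>

theorem proposition4p1:
  fixes M :: "'a measure" and Y C Z \<delta> :: "'a \<Rightarrow> real" and f\<^sub>Y f\<^sub>C :: "real \<Rightarrow> real"
  assumes "prob_space M"
    and "distributed M lborel Y (\<lambda>t. ennreal (f\<^sub>Y t))" and "\<And>t. 0 \<le> f\<^sub>Y t"
    and "distributed M lborel C (\<lambda>t. ennreal (f\<^sub>C t))" and "\<And>t. 0 \<le> f\<^sub>C t"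
    and "AE \<omega> in M. 0 \<le> Y \<omega>" and "AE \<omega> in M. 0 \<le> C \<omega>"
    and "prob_space.indep_var M borel Y borel C"
    and Z_def: "Z = (\<lambda>\<omega>. max (Y \<omega>) (C \<omega>))"
    and \<delta>_def: "\<delta> = indicator {\<omega>. Y \<omega> \<ge> C \<omega>}"
    and nondegenerate: "0 < measure M {\<omega> \<in> space M. \<delta> \<omega> = 1}" "measure M {\<omega> \<in> space M. \<delta> \<omega> = 1} < 1"
  shows "prob_space.indep_var M borel Z borel \<delta> \<longleftrightarrow>
    (\<exists>\<beta>>0. AE t in lborel. t \<ge> 0 \<longrightarrow>
       reversed_hazard_rate M C f\<^sub>C t = \<beta> * reversed_hazard_rate M Y f\<^sub>Y t)"
proof -
  interpret prob_space M by fact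
  note indep = \<open>indep_var borel Y borel C\<close>
    and Y = \<open>distributed M lborel Y (\<lambda>t. ennreal (f\<^sub>Y t))\<close>
    and C = \<open>distributed M lborel C (\<lambda>t. ennreal (f\<^sub>C t))\<close>
    and f\<^sub>Y = \<open>\<And>t. 0 \<le> f\<^sub>Y t\<close> and f\<^sub>C = \<open>\<And>t. 0 \<le> f\<^sub>C t\<close>
  note [measurable] = indep_var_rv1[OF indep] indep_var_rv2[OF indep]
  have indep': "indep_var borel C borel Y"
    using indep by (rule indep_var_swap)
  have Z [measurable]: "random_variable borel Z"
    unfolding Z_def by measurable
  have [measurable]: "f\<^sub>Y \<in> borel_measurable lborel" "f\<^sub>C \<in> borel_measurable lborel"
    using distributed_real_measurable[OF _ Y] distributed_real_measurable[OF _ C] f\<^sub>Y f\<^sub>C by simp_all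
  define F G where "F = cdf (distr M borel Y)" and "G = cdf (distr M borel C)"
  interpret Y: real_distribution "distr M borel Y"
    by (rule real_distribution_distr) simp
  interpret C: real_distribution "distr M borel C"
    by (rule real_distribution_distr) simp
  have FG [measurable]: "F \<in> borel_measurable borel" "G \<in> borel_measurable borel"
    unfolding F_def G_def
    by (simp_all add: borel_measurable_mono monoI Y.cdf_nondecreasing C.cdf_nondecreasing)
  have F0: "0 \<le> F t" and G0: "0 \<le> G t" for t
    by (simp_all add: F_def G_def Y.cdf_nonneg C.cdf_nonneg)
  have neq: "AE \<omega> in M. Y \<omega> \<noteq> C \<omega>"
    by (rule indep_var_atomless_neq[OF indep Y distributed_lborel_atomless[OF C]])
  \<comment> \<open>The law of \<open>Z\<close> is split according to the value of \<delta>.\<close>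
  define a\<^sub>1 a\<^sub>0 where "a\<^sub>1 A = prob {\<omega> \<in> space M. Z \<omega> \<in> A \<and> C \<omega> \<le> Y \<omega>}"
    and "a\<^sub>0 A = prob {\<omega> \<in> space M. Z \<omega> \<in> A \<and> \<not> C \<omega> \<le> Y \<omega>}" for A
  define p where "p = a\<^sub>1 UNIV"
  have p: "0 < p" "p < 1"
    using nondegenerate by (simp_all add: p_def a\<^sub>1_def \<delta>_def indicator_eq_1_iff)
  have a\<^sub>1: "ennreal (a\<^sub>1 A) = emeasure (density lborel (\<lambda>t. ennreal (f\<^sub>Y t * G t))) A"
    if "A \<in> sets borel" for A
  proof -
    have "{\<omega> \<in> space M. Z \<omega> \<in> A \<and> C \<omega> \<le> Y \<omega>} = {\<omega> \<in> space M. Y \<omega> \<in> A \<and> C \<omega> \<le> Y \<omega>}"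
      by (auto simp: Z_def max_def)
    then show ?thesis
      using emeasure_dominating_in[OF indep Y f\<^sub>Y that]
      by (simp add: a\<^sub>1_def G_def emeasure_eq_measure)
  qed
  have a\<^sub>0: "ennreal (a\<^sub>0 A) = emeasure (density lborel (\<lambda>t. ennreal (f\<^sub>C t * F t))) A"
    if [measurable]: "A \<in> sets borel" for A
  proof -
    \<comment> \<open>The event \<delta> = 0 is the strict inequality \<open>Y < C\<close>; adding
      the null set of ties gives the weak one that \<open>emeasure_dominating_in\<close>
      requires.\<close>
    have "a\<^sub>0 A = prob {\<omega> \<in> space M. C \<omega> \<in> A \<and> Y \<omega> \<le> C \<omega>}"
      unfolding a\<^sub>0_def using neq
      by (intro finite_measure_eq_AE) (auto simp: Z_def max_def elim!: eventually_mono)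
    then show ?thesis
      using emeasure_dominating_in[OF indep' C f\<^sub>C that]
      by (simp add: F_def emeasure_eq_measure)
  qed
  have total: "prob {\<omega> \<in> space M. Z \<omega> \<in> A} = a\<^sub>1 A + a\<^sub>0 A" if [measurable]: "A \<in> sets borel" for A
    unfolding a\<^sub>1_def a\<^sub>0_def
    by (subst finite_measure_Union[symmetric]) (auto intro!: arg_cong[where f = prob])
  have a_UNIV: "a\<^sub>1 UNIV + a\<^sub>0 UNIV = 1"
    using total[of UNIV] by (simp add: prob_space)
  \<comment> \<open>Two densities with respect to the sigma-finite Lebesgue measure define the same
    measure iff they agree almost everywhere.\<close>
  have proportional: "(\<forall>A \<in> sets borel. a\<^sub>0 A = c * a\<^sub>1 A) \<longleftrightarrow>
      (AE t in lborel. f\<^sub>C t * F t = c * (f\<^sub>Y t * G t))" if "0 \<le> c" for c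
  proof -
    have scale: "emeasure (density lborel (\<lambda>t. ennreal (c * (f\<^sub>Y t * G t)))) A = ennreal (c * a\<^sub>1 A)"
      if [measurable]: "A \<in> sets borel" for A
      using \<open>0 \<le> c\<close> f\<^sub>Y G0 a\<^sub>1[OF that]
      by (simp add: emeasure_density ennreal_mult nn_integral_cmult mult.assoc a\<^sub>1_def)
    have "(\<forall>A \<in> sets borel. a\<^sub>0 A = c * a\<^sub>1 A) \<longleftrightarrow>
        (\<forall>A \<in> sets borel. ennreal (a\<^sub>0 A) = ennreal (c * a\<^sub>1 A))"
      using \<open>0 \<le> c\<close> by (simp add: a\<^sub>0_def a\<^sub>1_def)
    also have "\<dots> \<longleftrightarrow> density lborel (\<lambda>t. ennreal (f\<^sub>C t * F t))
        = density lborel (\<lambda>t. ennreal (c * (f\<^sub>Y t * G t)))"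
      by (auto simp: a\<^sub>0 scale[symmetric] intro!: measure_eqI)
    also have "\<dots> \<longleftrightarrow> (AE t in lborel. f\<^sub>C t * F t = c * (f\<^sub>Y t * G t))"
      using \<open>0 \<le> c\<close> f\<^sub>Y f\<^sub>C F0 G0 by (subst sigma_finite_measure.density_unique_iff[OF sigma_finite_lborel]) auto
    finally show ?thesis .
  qed
  have indep_iff: "indep_var borel Z borel \<delta> \<longleftrightarrow>
      (\<forall>A \<in> sets borel. a\<^sub>1 A = (a\<^sub>1 A + a\<^sub>0 A) * p)"
  proof -
    have S: "{\<omega>. C \<omega> \<le> Y \<omega>} \<inter> space M = {\<omega> \<in> space M. C \<omega> \<le> Y \<omega>}"
      by auto
    show ?thesis
      unfolding \<delta>_def
      by (subst indep_var_indicator_iff) (auto simp: S p_def a\<^sub>1_def[symmetric] total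
          a\<^sub>1_def[of UNIV, simplified, symmetric])
  qed
  have hazard: "reversed_hazard_rate M Y f\<^sub>Y t = f\<^sub>Y t / F t"
    "reversed_hazard_rate M C f\<^sub>C t = f\<^sub>C t / G t" for t
    by (simp_all add: reversed_hazard_rate_def F_def G_def)
  show ?thesis
    unfolding hazard
  proof
    assume "indep_var borel Z borel \<delta>"
    then have eq: "a\<^sub>1 A = (a\<^sub>1 A + a\<^sub>0 A) * p" if "A \<in> sets borel" for A
      using that indep_iff by blast
    have Z_le: "a\<^sub>1 {..t} + a\<^sub>0 {..t} = F t * G t" for t
    proof -
      have "a\<^sub>1 {..t} + a\<^sub>0 {..t} = prob ((\<lambda>\<omega>. (Y \<omega>, C \<omega>)) -` ({..t} \<times> {..t}) \<inter> space M)"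
        by (subst total[symmetric]) (auto simp: Z_def intro!: arg_cong[where f = prob])
      also have "\<dots> = F t * G t"
        by (subst indep_varD[OF indep]) (auto simp: F_def G_def cdf_def measure_distr)
      finally show ?thesis .
    qed
    \<comment> \<open>Independence gives \<open>a\<^sub>1 {..t} = p * (F t * G t)\<close>, the bound
      needed for the transfer from \<open>F\<close> to \<open>G\<close>.\<close>
    have "G t = 0" if "F t = 0" for t
      unfolding G_def
    proof (rule cdf_zero_transfer[OF indep distributed_lborel_atomless[OF Y] p(2)])
      fix t
      have "prob {\<omega> \<in> space M. Y \<omega> \<le> t \<and> C \<omega> < Y \<omega>} \<le> a\<^sub>1 {..t}"
        unfolding a\<^sub>1_def by (rule finite_measure_mono) (auto simp: Z_def)
      also have "\<dots> = p * (F t * G t)"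
        using eq[of "{..t}"] Z_le[of t] by simp
      finally show "prob {\<omega> \<in> space M. Y \<omega> \<le> t \<and> C \<omega> < Y \<omega>} \<le>
          p * (cdf (distr M borel Y) t * cdf (distr M borel C) t)"
        by (simp add: F_def G_def)
    qed (use that in \<open>simp add: F_def\<close>)
    \<comment> \<open>The same argument on \<delta> = 0, with the complementary probability
      \<open>1 - p\<close>.\<close>
    moreover have "F t = 0" if "G t = 0" for t
      unfolding F_def
    proof (rule cdf_zero_transfer[OF indep' distributed_lborel_atomless[OF C]])
      show "1 - p < 1"
        using p by simp
      fix t
      have "prob {\<omega> \<in> space M. C \<omega> \<le> t \<and> Y \<omega> < C \<omega>} \<le> a\<^sub>0 {..t}"
        unfolding a\<^sub>0_def by (rule finite_measure_mono) (auto simp: Z_def)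
      also have "\<dots> = (1 - p) * (a\<^sub>1 {..t} + a\<^sub>0 {..t})"
        using eq[of "{..t}"] by (simp add: algebra_simps)
      also have "\<dots> = (1 - p) * (G t * F t)"
        by (simp add: Z_le)
      finally show "prob {\<omega> \<in> space M. C \<omega> \<le> t \<and> Y \<omega> < C \<omega>} \<le>
          (1 - p) * (cdf (distr M borel C) t * cdf (distr M borel Y) t)"
        by (simp add: F_def G_def)
    qed (use that in \<open>simp add: G_def\<close>)
    ultimately have zeros: "F t = 0 \<longleftrightarrow> G t = 0" for t
      by blast
    \<comment> \<open>The solution of \<open>a\<^sub>1 A = (a\<^sub>1 A + a\<^sub>0 A) * p\<close>
      for the ratio of \<open>a\<^sub>0 A\<close> to \<open>a\<^sub>1 A\<close>: the odds of
      \<delta> = 0 against \<delta> = 1.\<close>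
    define \<beta> where "\<beta> = (1 - p) / p"
    have "\<beta> > 0"
      using p by (simp add: \<beta>_def)
    have "a\<^sub>0 A = \<beta> * a\<^sub>1 A" if "A \<in> sets borel" for A
      using eq[OF that] p by (simp add: \<beta>_def field_simps)
    then have "AE t in lborel. f\<^sub>C t * F t = \<beta> * (f\<^sub>Y t * G t)"
      using proportional[of \<beta>] \<open>\<beta> > 0\<close> by simp
    then have "AE t in lborel. t \<ge> 0 \<longrightarrow> f\<^sub>C t / G t = \<beta> * (f\<^sub>Y t / F t)"
    \<comment> \<open>At a common zero of \<open>F\<close> and \<open>G\<close> both quotients are 0
      by convention; elsewhere both are nonzero and the equation is divided by
      \<open>F t * G t\<close>.\<close>
    proof eventually_elim
      fix t assume "f\<^sub>C t * F t = \<beta> * (f\<^sub>Y t * G t)"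
      then show "t \<ge> 0 \<longrightarrow> f\<^sub>C t / G t = \<beta> * (f\<^sub>Y t / F t)"
        using zeros[of t] by (cases "F t = 0") (simp_all add: field_simps)
    qed
    then show "\<exists>\<beta>>0. AE t in lborel. t \<ge> 0 \<longrightarrow> f\<^sub>C t / G t = \<beta> * (f\<^sub>Y t / F t)"
      using \<open>\<beta> > 0\<close> by blast
  next
    assume "\<exists>\<beta>>0. AE t in lborel. t \<ge> 0 \<longrightarrow> f\<^sub>C t / G t = \<beta> * (f\<^sub>Y t / F t)"
    then obtain \<beta> where "\<beta> > 0"
      and rate: "AE t in lborel. t \<ge> 0 \<longrightarrow> f\<^sub>C t / G t = \<beta> * (f\<^sub>Y t / F t)"
      by blast
    \<comment> \<open>The rates are compared only for \<open>t \<ge> 0\<close>. For negative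
      \<open>t\<close> this gives \<open>F t = 0\<close>, and then \<open>f\<^sub>Y t = 0\<close>
      almost everywhere, so both sides of the next equation vanish.\<close>
    have F_neg: "F t = 0" if "t < 0" for t
      unfolding F_def using that \<open>AE \<omega> in M. 0 \<le> Y \<omega>\<close> by (intro cdf_nonneg_variable) auto
    have "AE t in lborel. f\<^sub>C t * F t = \<beta> * (f\<^sub>Y t * G t)"
      using rate AE_density_zero_where_cdf_zero[OF Y f\<^sub>Y, folded F_def]
        AE_density_zero_where_cdf_zero[OF C f\<^sub>C, folded G_def]
    proof eventually_elim
      fix t
      assume "t \<ge> 0 \<longrightarrow> f\<^sub>C t / G t = \<beta> * (f\<^sub>Y t / F t)" "F t = 0 \<longrightarrow> f\<^sub>Y t = 0" "G t = 0 \<longrightarrow> f\<^sub>C t = 0"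
      \<comment> \<open>If \<open>F t\<close> or \<open>G t\<close> is 0, the matching density is 0
        too and both sides vanish; otherwise \<open>t \<ge> 0\<close> and the denominators are
        cleared.\<close>
      then show "f\<^sub>C t * F t = \<beta> * (f\<^sub>Y t * G t)"
        using F_neg[of t] by (cases "F t = 0"; cases "G t = 0") (auto simp: field_simps not_le)
    qed
    then have a: "a\<^sub>0 A = \<beta> * a\<^sub>1 A" if "A \<in> sets borel" for A
      using proportional[of \<beta>] \<open>\<beta> > 0\<close> that by simp
    \<comment> \<open>Total mass 1 splits as \<open>p\<close> plus \<beta> times \<open>p\<close>,
      so \<beta> determines \<open>p\<close> as the constant the independence criterion
      requires.\<close>
    have "p * (1 + \<beta>) = 1"
      using a[of UNIV] a_UNIV by (simp add: p_def algebra_simps)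
    have "a\<^sub>1 A = (a\<^sub>1 A + a\<^sub>0 A) * p" if "A \<in> sets borel" for A
    proof -
      have "(a\<^sub>1 A + a\<^sub>0 A) * p = a\<^sub>1 A * (p * (1 + \<beta>))"
        by (simp add: a[OF that] algebra_simps)
      then show ?thesis
        by (simp add: \<open>p * (1 + \<beta>) = 1\<close>)
    qed
    then show "indep_var borel Z borel \<delta>"
      using indep_iff by blast
  qed
qed

end
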